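(* Let $\mathcal{H}$ be a real Hilbert space. Let $f:\mathcal{H}\to\mathbb{R}$ be Fréchet differentiable with $\beta$-Lipschitz continuous gradient $\nabla f$. Let $\mathcal{Q}:\mathcal{H}\to\mathcal{H}$ be linear, bounded, self-adjoint, with closed range, and degenerate, i.e. positive semi-definite with $\ker\mathcal{Q}\setminus\{0\}\neq\emptyset$. Assume $\mathrm{ran}\,\nabla f\subseteq\mathrm{ran}\,\mathcal{Q}$. Let $\nu\in\,]0,+\infty[$ be a constant with $\|\mathcal{Q}x\|\ge\nu\|x\|$ for all $x\in(\ker\mathcal{Q})^\perp=\mathrm{ran}\,\mathcal{Q}$. Then $$f(x_2)\le f(x_1)+\big\langle\mathcal{Q}(x_2-x_1)\,\big|\,\mathcal{Q}^\dagger\nabla f(x_1)\big\rangle+\frac{\beta}{2\nu}\|x_2-x_1\|_{\mathcal{Q}}^2,\qquad\forall(x_1,x_2)\in\mathcal{H}\times\mathcal{H}.$$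
   Context: $\mathcal{Q}^\dagger$ is the Moore–Penrose pseudo-inverse of $\mathcal{Q}$, and $\|x\|_{\mathcal{Q}}^2:=\langle\mathcal{Q}x|x\rangle$ (a seminorm when $\mathcal{Q}$ is degenerate). *)

theory Defs
  imports "HOL-Analysis.Analysis"
begin

abbreviation ker :: "('a::real_vector \<Rightarrow> 'b::real_vector) \<Rightarrow> 'a set"
  where "ker T \<equiv> {x. T x = 0}"

text \<open>
  The library constant \<^const>\<open>adjoint\<close> picks some function with \<open>T x \<bullet> y = x \<bullet> T' y\<close>;
  when there is none it is arbitrary. Self-adjointness is therefore stated through
  the defining identity.
\<close>

definition self_adjoint :: "('a::real_inner \<Rightarrow> 'a) \<Rightarrow> bool"
  where "self_adjoint T \<longleftrightarrow> (\<forall>x y. T x \<bullet> y = x \<bullet> T y)"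

lemma self_adjoint_imp_adjoint_eq: "self_adjoint T \<Longrightarrow> adjoint T = T"
  by (simp add: self_adjoint_def adjoint_unique)

definition degenerate :: "('a::real_inner \<Rightarrow> 'a) \<Rightarrow> bool"
  where "degenerate T \<longleftrightarrow> (\<forall>x. 0 \<le> T x \<bullet> x) \<and> ker T - {0} \<noteq> {}"

text \<open>
  The four Penrose equations. On Hilbert spaces, a bounded linear \<open>T\<close> has a bounded linear
  solution \<open>X\<close> exactly when its range is closed; otherwise \<open>moore_penrose T\<close> is unspecified.
\<close>

definition is_moore_penrose :: "('a::real_inner \<Rightarrow> 'b::real_inner) \<Rightarrow> ('b \<Rightarrow> 'a) \<Rightarrow> bool"
  where "is_moore_penrose T X \<longleftrightarrow> bounded_linear X \<and>
    T \<circ> X \<circ> T = T \<and> X \<circ> T \<circ> X = X \<and> self_adjoint (T \<circ> X) \<and> self_adjoint (X \<circ> T)"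

definition moore_penrose :: "('a::real_inner \<Rightarrow> 'b::real_inner) \<Rightarrow> 'b \<Rightarrow> 'a"
  where "moore_penrose T = (THE X. is_moore_penrose T X)"

lemma is_moore_penrose_unique:
  assumes "is_moore_penrose T X" "is_moore_penrose T Y"
  shows "X = Y"
proof -
  have X: "T (X (T x)) = T x" "X (T (X y)) = X y"
    "T (X y) \<bullet> z = y \<bullet> T (X z)" "X (T x) \<bullet> w = x \<bullet> X (T w)" for x y z w
    using assms(1) by (auto simp: is_moore_penrose_def self_adjoint_def fun_eq_iff)
  have Y: "T (Y (T x)) = T x" "Y (T (Y y)) = Y y"
    "T (Y y) \<bullet> z = y \<bullet> T (Y z)" "Y (T x) \<bullet> w = x \<bullet> Y (T w)" for x y z w
    using assms(2) by (auto simp: is_moore_penrose_def self_adjoint_def fun_eq_iff)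
  have TXY: "T (X y) = T (Y y)" for y
  proof -
    have "T (X y) \<bullet> z = T (Y y) \<bullet> z" for z
      by (metis X(1,3) Y(1,3))
    then show ?thesis
      by (metis vector_eq_rdot)
  qed
  have XYT: "X (T x) = Y (T x)" for x
  proof -
    have "X (T x) \<bullet> w = Y (T x) \<bullet> w" for w
      by (metis X(1,4) Y(1,4))
    then show ?thesis
      by (metis vector_eq_rdot)
  qed
  show ?thesis
    by (rule ext) (metis X(2) Y(2) TXY XYT)
qed

lemma moore_penrose_eqI: "is_moore_penrose T X \<Longrightarrow> moore_penrose T = X"
  unfolding moore_penrose_def by (blast intro: is_moore_penrose_unique the_equality)

text \<open>The square of the seminorm induced by a positive semi-definite operator.\<close>

definition seminorm_sq :: "('a::real_inner \<Rightarrow> 'a) \<Rightarrow> 'a \<Rightarrow> real"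
  where "seminorm_sq T x = T x \<bullet> x"

end

(*
  The range of Q is orthogonal to its kernel, so f is constant along ker Q, and Q maps ran Q
  bijectively onto itself; the inverse of this bijection, composed with the orthogonal projection
  P = Q Q^+ onto ran Q, is Q^+. The usual descent inequality at x1 in the direction P (x2 - x1)
  therefore bounds f x2, with quadratic term ||P (x2 - x1)||^2. Finally Q^+ is positive
  semi-definite with norm at most 1/nu, hence ||Q^+ w||^2 <= <Q^+ w | w> / nu, and w = Q x turns
  this into ||P x||^2 <= <Q x | x> / nu.
*)
theory Submission
  imports Defs
begin

section \<open>Differentiable functions along straight lines\<close>

lemma descent_inequality:
  fixes f :: "'a::real_inner \<Rightarrow> real"
  assumes grad: "\<And>x. GDERIV f x :> g x" and lip: "\<beta>-lipschitz_on UNIV g"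
  shows "f (x + e) \<le> f x + e \<bullet> g x + \<beta> / 2 * (norm e)\<^sup>2"
proof -
  \<comment> \<open>\<open>\<phi>\<close> compares \<open>f\<close> with its quadratic upper model
    on the segment from \<open>x\<close> to \<open>x + e\<close>. Cauchy-Schwarz and the Lipschitz
    bound make its derivative nonpositive, so no integral of the gradient is needed.\<close>
  define \<phi> where "\<phi> t = f (x + t *\<^sub>R e) - t * (e \<bullet> g x) - \<beta> / 2 * t\<^sup>2 * (norm e)\<^sup>2" for t
  have "\<phi> 0 \<ge> \<phi> 1"
  proof (rule DERIV_nonpos_imp_nonincreasing[of 0 1 \<phi>])
    fix t :: real
    assume "0 \<le> t" "t \<le> 1"
    have "((\<lambda>t. x + t *\<^sub>R e) has_derivative (\<lambda>h. h *\<^sub>R e)) (at t)"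
      by (auto intro!: derivative_eq_intros)
    from has_derivative_compose[OF this grad[unfolded gderiv_def]]
    have "((\<lambda>t. f (x + t *\<^sub>R e)) has_derivative (\<lambda>h. (h *\<^sub>R e) \<bullet> g (x + t *\<^sub>R e))) (at t)" .
    then have "((\<lambda>t. f (x + t *\<^sub>R e)) has_real_derivative e \<bullet> g (x + t *\<^sub>R e)) (at t)"
      by (simp add: has_field_derivative_def mult_commute_abs)
    then have deriv: "(\<phi> has_real_derivative
        e \<bullet> g (x + t *\<^sub>R e) - e \<bullet> g x - \<beta> * t * (norm e)\<^sup>2) (at t)"
      unfolding \<phi>_def by (auto intro!: derivative_eq_intros)
    have "e \<bullet> (g (x + t *\<^sub>R e) - g x) \<le> norm e * norm (g (x + t *\<^sub>R e) - g x)"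
      by (rule norm_cauchy_schwarz)
    also have "\<dots> \<le> norm e * (\<beta> * (t * norm e))"
      using lipschitz_onD[OF lip, of "x + t *\<^sub>R e" x] \<open>0 \<le> t\<close>
      by (intro mult_left_mono) (auto simp: dist_norm)
    finally have "e \<bullet> g (x + t *\<^sub>R e) - e \<bullet> g x - \<beta> * t * (norm e)\<^sup>2 \<le> 0"
      by (simp add: inner_diff_right power2_eq_square mult_ac)
    with deriv show "\<exists>y. (\<phi> has_real_derivative y) (at t) \<and> y \<le> 0"
      by blast
  qed simp
  then show ?thesis
    by (simp add: \<phi>_def)
qed

lemma eq_along_gradient_orthogonal:
  fixes f :: "'a::real_inner \<Rightarrow> real"
  assumes grad: "\<And>x. GDERIV f x :> g x" and orth: "\<And>x. n \<bullet> g x = 0"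
  shows "f (x + n) = f x"
proof -
  have "((\<lambda>t. f (x + t *\<^sub>R n)) has_real_derivative 0) (at t)" for t
  proof -
    have "((\<lambda>t. x + t *\<^sub>R n) has_derivative (\<lambda>h. h *\<^sub>R n)) (at t)"
      by (auto intro!: derivative_eq_intros)
    from has_derivative_compose[OF this grad[unfolded gderiv_def]]
    show ?thesis
      by (simp add: has_field_derivative_def orth lambda_zero)
  qed
  then have "f (x + 1 *\<^sub>R n) = f (x + 0 *\<^sub>R n)"
    by (intro DERIV_isconst_all[of "\<lambda>t. f (x + t *\<^sub>R n)"]) blast
  then show ?thesis
    by simp
qed

text \<open>Positivity is tested at \<open>x - t *\<^sub>R A x\<close>, which avoids a square root
  of \<open>A\<close>. The lemma serves twice: for \<open>Q\<close>, to get a contraction, and for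
  its pseudo-inverse, to get the factor \<open>1 / \<nu>\<close>.\<close>

lemma psd_norm_sq_le:
  fixes A :: "'a::real_inner \<Rightarrow> 'a"
  assumes lin: "linear A" and sa: "self_adjoint A" and psd: "\<And>x. 0 \<le> A x \<bullet> x"
    and bound: "\<And>x. norm (A x) \<le> C * norm x" and "C > 0"
  shows "(norm (A x))\<^sup>2 \<le> C * (A x \<bullet> x)"
proof -
  have "A (A x) \<bullet> A x \<le> norm (A (A x)) * norm (A x)"
    by (rule norm_cauchy_schwarz)
  also have "\<dots> \<le> C * norm (A x) * norm (A x)"
    by (intro mult_right_mono bound) simp
  finally have le: "A (A x) \<bullet> A x \<le> C * (norm (A x))\<^sup>2"
    by (simp add: power2_eq_square)
  \<comment> \<open>This value minimises the upper bound \<open>A x \<bullet> x - 2 * t * (norm (A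
    x))\<^sup>2 + t\<^sup>2 * C * (norm (A x))\<^sup>2\<close> over \<open>t\<close>.\<close>
  let ?t = "1 / C"
  have "0 \<le> A (x - ?t *\<^sub>R A x) \<bullet> (x - ?t *\<^sub>R A x)"
    by (rule psd)
  also have "\<dots> = A x \<bullet> x - 2 * ?t * (norm (A x))\<^sup>2 + ?t\<^sup>2 * (A (A x) \<bullet> A x)"
    using sa[unfolded self_adjoint_def, rule_format, of "A x" x]
    by (simp add: linear_diff[OF lin] linear_scale[OF lin] inner_diff_left inner_diff_right
        dot_square_norm power2_eq_square algebra_simps)
  also have "\<dots> \<le> A x \<bullet> x - 2 * ?t * (norm (A x))\<^sup>2 + ?t\<^sup>2 * (C * (norm (A x))\<^sup>2)"
    by (intro add_left_mono mult_left_mono le) simp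
  also have "\<dots> = A x \<bullet> x - (norm (A x))\<^sup>2 / C"
    using \<open>C > 0\<close> by (simp add: power2_eq_square field_simps)
  finally show ?thesis
    using \<open>C > 0\<close> by (simp add: field_simps)
qed

section \<open>Solving equations within the range of \<open>Q\<close>, and the
  pseudo-inverse\<close>

locale psd_closed_range =
  fixes Q :: "'a::{real_inner, complete_space} \<Rightarrow> 'a" and \<nu> :: real
  assumes bounded_linear: "bounded_linear Q"
    and self_adjoint: "self_adjoint Q"
    and psd: "0 \<le> Q x \<bullet> x"
    and closed_range: "closed (range Q)"
    and pos: "0 < \<nu>"
    and lower_bound: "u \<in> range Q \<Longrightarrow> \<nu> * norm u \<le> norm (Q u)"
begin

lemma linear: "linear Q"
  by (rule bounded_linear.linear[OF bounded_linear])

lemma subspace_range: "subspace (range Q)"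
  by (rule linear_subspace_image[OF linear subspace_UNIV])

lemma inner_swap: "Q x \<bullet> y = x \<bullet> Q y"
  using self_adjoint by (simp add: self_adjoint_def)

lemma ker_orthogonal_range: "Q n = 0 \<Longrightarrow> u \<in> range Q \<Longrightarrow> n \<bullet> u = 0"
  by (auto simp flip: inner_swap)

lemma inj_on_range:
  assumes "u \<in> range Q" "v \<in> range Q" "Q u = Q v"
  shows "u = v"
proof -
  have "\<nu> * norm (u - v) \<le> norm (Q (u - v))"
    using assms by (intro lower_bound subspace_diff subspace_range)
  then have "\<nu> * norm (u - v) \<le> 0"
    using assms(3) by (simp add: linear_diff[OF linear])
  then show ?thesis
    using pos by (simp add: mult_le_0_iff)
qed

text \<open>For \<open>K \<ge> \<parallel>Q\<parallel>\<close>, the gradient step \<open>u \<mapsto> u - (Q u - y) / K\<close> is a contraction of \<open>ran Q\<close>; its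
  fixed point solves \<open>Q u = y\<close>. This avoids the projection theorem for Hilbert spaces.\<close>

lemma range_subset_image_range:
  assumes y: "y \<in> range Q"
  shows "\<exists>u\<in>range Q. Q u = y"
proof -
  obtain K0 where K0: "K0 > 0" "\<And>x. norm (Q x) \<le> norm x * K0"
    using bounded_linear.pos_bounded[OF bounded_linear] by blast
  \<comment> \<open>The maximum keeps \<open>\<nu> / K\<close> at most 1 even for
    \<open>Q = 0\<close>, where \<open>\<nu>\<close> is arbitrary; so the root in \<open>c\<close>
    is taken of a nonnegative number.\<close>
  define K where "K = max K0 \<nu>"
  have K: "K > 0" "\<nu> \<le> K"
    using K0 by (auto simp: K_def)
  have bound: "norm (Q x) \<le> K * norm x" for x
    by (rule order_trans[OF K0(2)]) (metis K_def max.cobounded1 mult.commute mult_right_mono norm_ge_zero)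
  define c where "c = sqrt (1 - (\<nu> / K)\<^sup>2)"
  have ratio: "0 < \<nu> / K" "\<nu> / K \<le> 1"
    using K pos by auto
  then have ratio_sq: "0 < (\<nu> / K)\<^sup>2" "(\<nu> / K)\<^sup>2 \<le> 1"
    by (auto simp: power_le_one simp del: divide_le_eq_1_pos)
  then have c: "0 \<le> c" "c < 1" "c\<^sup>2 = 1 - (\<nu> / K)\<^sup>2"
    by (auto simp: c_def)
  define T where "T u = u - (1 / K) *\<^sub>R (Q u - y)" for u
  have T_diff: "T u - T v = (u - v) - (1 / K) *\<^sub>R Q (u - v)" for u v
    by (simp add: T_def linear_diff[OF linear] algebra_simps)
  \<comment> \<open>By \<open>psd_norm_sq_le\<close> the cross term of the expanded square is at
    least twice the last term, which leaves at most
    \<open>(norm e)\<^sup>2 - (norm (Q e))\<^sup>2 / K\<^sup>2\<close>. The lower bound for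
    \<open>Q\<close> on its range then dictates the choice of \<open>c\<close>.\<close>
  have contr: "norm (e - (1 / K) *\<^sub>R Q e) \<le> c * norm e" if "e \<in> range Q" for e
  proof -
    have Qe: "(norm (Q e))\<^sup>2 \<le> K * (Q e \<bullet> e)"
      by (rule psd_norm_sq_le[OF linear self_adjoint psd bound K(1)])
    have "(\<nu> * norm e)\<^sup>2 \<le> (norm (Q e))\<^sup>2"
      using lower_bound[OF that] pos by (intro power_mono) auto
    then have low: "(\<nu> / K)\<^sup>2 * (norm e)\<^sup>2 \<le> (norm (Q e))\<^sup>2 / K\<^sup>2"
      using K by (simp add: power_mult_distrib power_divide divide_right_mono)
    have "(norm (e - (1 / K) *\<^sub>R Q e))\<^sup>2
        = (norm e)\<^sup>2 - 2 * (Q e \<bullet> e) / K + (norm (Q e))\<^sup>2 / K\<^sup>2"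
      unfolding power2_norm_eq_inner
      by (simp add: inner_diff_left inner_diff_right inner_commute power2_eq_square)
    also have "\<dots> \<le> (norm e)\<^sup>2 - 2 * ((norm (Q e))\<^sup>2 / K\<^sup>2) + (norm (Q e))\<^sup>2 / K\<^sup>2"
      using Qe K by (simp add: field_simps power2_eq_square)
    also have "\<dots> \<le> (c * norm e)\<^sup>2"
      using low by (simp add: power_mult_distrib c(3) left_diff_distrib)
    finally show ?thesis
      by (rule power2_le_imp_le) (simp add: c(1))
  qed
  have "\<exists>!u\<in>range Q. T u = u"
  proof (rule Banach_fix[of _ c])
    show "complete (range Q)"
      using closed_range complete_eq_closed by blast
    show "T ` range Q \<subseteq> range Q"
      unfolding T_def using y
      by (auto intro!: subspace_diff subspace_scale subspace_range)
    show "dist (T u) (T v) \<le> c * dist u v" if "u \<in> range Q" "v \<in> range Q" for u v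
      unfolding dist_norm T_diff using that by (intro contr subspace_diff subspace_range) auto
  qed (use c in auto)
  then show ?thesis
    using K by (auto simp: T_def)
qed

text \<open>The projection of \<open>h\<close> onto \<open>range Q\<close> is the only
  \<open>u\<close> there with \<open>Q u = Q h\<close>, and \<open>pinv h\<close> is the preimage of
  \<open>u\<close> within the range. Applying \<open>Q\<close> once more states this without
  mentioning the projection.\<close>

definition pinv :: "'a \<Rightarrow> 'a"
  where "pinv h = (SOME v. v \<in> range Q \<and> Q (Q v) = Q h)"

lemma pinv: "pinv h \<in> range Q" "Q (Q (pinv h)) = Q h"
proof -
  obtain u where u: "u \<in> range Q" "Q u = Q h"
    using range_subset_image_range[OF rangeI] by metis
  obtain v where "v \<in> range Q" "Q v = u"
    using range_subset_image_range[OF u(1)] by metis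
  with u have "v \<in> range Q \<and> Q (Q v) = Q h"
    by simp
  then have "pinv h \<in> range Q \<and> Q (Q (pinv h)) = Q h"
    unfolding pinv_def by (rule someI)
  then show "pinv h \<in> range Q" "Q (Q (pinv h)) = Q h"
    by simp_all
qed

lemma Q_pinv_eqI: "u \<in> range Q \<Longrightarrow> Q u = Q h \<Longrightarrow> Q (pinv h) = u"
  by (rule inj_on_range) (simp_all add: pinv)

text \<open>Injectivity on the range is used twice, to cancel both applications of \<open>Q\<close>.
  Linearity of \<open>pinv\<close> and its commutation with \<open>Q\<close> then need only a
  candidate value.\<close>

lemma pinv_eqI: "v \<in> range Q \<Longrightarrow> Q (Q v) = Q h \<Longrightarrow> pinv h = v"
  by (rule inj_on_range[OF pinv(1)]) (simp_all add: Q_pinv_eqI)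

lemma pinv_Q: "pinv (Q h) = Q (pinv h)"
  by (rule pinv_eqI) (simp_all add: pinv)

text \<open>The remainder \<open>h - Q (pinv h)\<close> lies in the kernel, hence is orthogonal to
  the range: \<open>Q \<circ> pinv\<close> is the orthogonal projection.\<close>

lemma inner_Q_pinv: "u \<in> range Q \<Longrightarrow> u \<bullet> Q (pinv h) = u \<bullet> h"
  using ker_orthogonal_range[of "h - Q (pinv h)" u]
  by (simp add: linear_diff[OF linear] pinv inner_diff_left inner_commute[of u])

lemma self_adjoint_Q_pinv: "Q (pinv x) \<bullet> y = x \<bullet> Q (pinv y)"
  using inner_Q_pinv[OF rangeI, of "pinv x" y] inner_Q_pinv[OF rangeI, of "pinv y" x]
  by (simp only: inner_commute)

lemma norm_Q_pinv_le: "norm (Q (pinv h)) \<le> norm h"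
proof (cases "norm (Q (pinv h)) = 0")
  case False
  have "norm (Q (pinv h)) * norm (Q (pinv h)) = Q (pinv h) \<bullet> h"
    by (metis dot_square_norm inner_Q_pinv power2_eq_square rangeI)
  also have "\<dots> \<le> norm (Q (pinv h)) * norm h"
    by (rule norm_cauchy_schwarz)
  finally show ?thesis
    by (rule mult_left_le_imp_le) (use False in simp)
qed simp

lemma norm_pinv_le: "norm (pinv h) \<le> 1 / \<nu> * norm h"
proof -
  have "\<nu> * norm (pinv h) \<le> norm h"
    by (rule order_trans[OF lower_bound[OF pinv(1)] norm_Q_pinv_le])
  then show ?thesis
    using pos by (simp add: pos_le_divide_eq mult.commute)
qed

lemma bounded_linear_pinv: "bounded_linear pinv"
proof (rule bounded_linear_intro)
  show "pinv (x + y) = pinv x + pinv y" for x y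
    by (rule pinv_eqI) (simp_all add: subspace_add subspace_range pinv linear_add[OF linear])
  show "pinv (r *\<^sub>R x) = r *\<^sub>R pinv x" for r x
    by (rule pinv_eqI) (simp_all add: subspace_scale subspace_range pinv linear_scale[OF linear])
  show "norm (pinv h) \<le> norm h * (1 / \<nu>)" for h
    using norm_pinv_le[of h] by (simp add: mult.commute)
qed

lemma is_moore_penrose_pinv: "is_moore_penrose Q pinv"
proof -
  have "pinv (Q (pinv h)) = pinv h" for h
    by (rule pinv_eqI) (simp_all add: pinv)
  then show ?thesis
    unfolding is_moore_penrose_def
    by (auto simp: fun_eq_iff self_adjoint_def bounded_linear_pinv pinv pinv_Q self_adjoint_Q_pinv)
qed

lemma moore_penrose_eq_pinv: "moore_penrose Q = pinv"
  by (rule moore_penrose_eqI[OF is_moore_penrose_pinv])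

text \<open>This transfers symmetry and positivity from \<open>Q\<close> to
  \<open>pinv\<close>.\<close>

lemma inner_pinv: "pinv x \<bullet> y = Q (pinv x) \<bullet> pinv y"
  using inner_Q_pinv[OF pinv(1), of x y] by (simp add: inner_swap)

lemma norm_projection_sq_le: "(norm (Q (pinv x)))\<^sup>2 \<le> 1 / \<nu> * (Q x \<bullet> x)"
proof -
  have "(norm (pinv (Q x)))\<^sup>2 \<le> 1 / \<nu> * (pinv (Q x) \<bullet> Q x)"
  proof (rule psd_norm_sq_le)
    show "linear pinv"
      by (rule bounded_linear.linear[OF bounded_linear_pinv])
    show "self_adjoint pinv"
      unfolding self_adjoint_def
    proof (intro allI)
      show "pinv y \<bullet> z = y \<bullet> pinv z" for y z
        using inner_pinv[of y z] inner_pinv[of z y] inner_swap[of "pinv y" "pinv z"]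
        by (simp only: inner_commute)
    qed
    show "0 \<le> pinv h \<bullet> h" for h
      by (simp add: inner_pinv psd)
  qed (use pos norm_pinv_le in auto)
  \<comment> \<open>By commutation \<open>pinv (Q x)\<close> is the projection of \<open>x\<close>,
    and projecting \<open>x\<close> does not change its inner product with the range element
    \<open>Q x\<close>.\<close>
  moreover have "pinv (Q x) \<bullet> Q x = Q x \<bullet> x"
    using inner_Q_pinv[of "Q x" x] by (simp add: pinv_Q inner_commute)
  ultimately show ?thesis
    by (simp add: pinv_Q)
qed

end

theorem lemma3p3:
  fixes f :: "'a::{real_inner, complete_space} \<Rightarrow> real"
    and grad_f :: "'a \<Rightarrow> 'a"
    and Q :: "'a \<Rightarrow> 'a"
    and \<beta> \<nu> :: real
  assumes "\<And>x. GDERIV f x :> grad_f x"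
    and "\<beta>-lipschitz_on UNIV grad_f"
    and "bounded_linear Q"
    and "self_adjoint Q"
    and "closed (range Q)"
    and "degenerate Q"
    and "range grad_f \<subseteq> range Q"
    and "0 < \<nu>"
    and "\<And>x. x \<in> orthogonal_comp (ker Q) \<Longrightarrow> \<nu> * norm x \<le> norm (Q x)"
  shows "\<forall>x1 x2. f x2 \<le> f x1 + Q (x2 - x1) \<bullet> moore_penrose Q (grad_f x1)
           + \<beta> / (2 * \<nu>) * seminorm_sq Q (x2 - x1)"
proof (intro allI)
  fix x1 x2 :: 'a
  \<comment> \<open>Self-adjointness places the range inside the orthogonal complement of the
    kernel, so the assumed lower bound applies on the range.\<close>
  have "y \<bullet> Q z = 0" if "Q y = 0" for y z
    using assms(4)[unfolded self_adjoint_def, rule_format, of y z] that by simp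
  then have "range Q \<subseteq> orthogonal_comp (ker Q)"
    by (auto simp: orthogonal_comp_def orthogonal_def)
  then interpret psd_closed_range Q \<nu>
    using assms(3-6,8) by (intro psd_closed_range.intro assms(9)) (auto simp: degenerate_def)
  have grad_range: "grad_f x \<in> range Q" for x
    using assms(7) by blast
  define d where "d = x2 - x1"
  define p where "p = Q (pinv d)"
  have "f (x1 + p + (d - p)) = f (x1 + p)"
  proof (rule eq_along_gradient_orthogonal[OF assms(1)])
    show "(d - p) \<bullet> grad_f x = 0" for x
      by (rule ker_orthogonal_range[OF _ grad_range])
        (simp add: p_def linear_diff[OF linear] pinv)
  qed
  then have "f x2 = f (x1 + p)"
    by (simp add: d_def)
  also have "\<dots> \<le> f x1 + p \<bullet> grad_f x1 + \<beta> / 2 * (norm p)\<^sup>2"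
    by (rule descent_inequality[OF assms(1,2)])
  \<comment> \<open>First the projection moves to the gradient, then its outer \<open>Q\<close>
    moves back to \<open>d\<close>.\<close>
  also have "p \<bullet> grad_f x1 = Q d \<bullet> pinv (grad_f x1)"
    unfolding p_def self_adjoint_Q_pinv inner_swap[of d] ..
  also have "\<beta> / 2 * (norm p)\<^sup>2 \<le> \<beta> / 2 * (1 / \<nu> * (Q d \<bullet> d))"
    unfolding p_def using lipschitz_on_nonneg[OF assms(2)]
    by (intro mult_left_mono norm_projection_sq_le) simp
  finally show "f x2 \<le> f x1 + Q (x2 - x1) \<bullet> moore_penrose Q (grad_f x1)
      + \<beta> / (2 * \<nu>) * seminorm_sq Q (x2 - x1)"
    by (simp add: d_def moore_penrose_eq_pinv seminorm_sq_def)
qed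

end
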